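(* Let $V$ be a real reflexive Banach space, $X$ a real Hilbert space, $\gamma:V\to X$ a continuous linear operator, $J:X\to\mathbb{R}$ a locally Lipschitz functional with generalized directional derivative $J^0$, and $F:V\to\mathbb{R}\cup\{+\infty\}$ a convex lower semicontinuous proper function. Let $\mathcal{A}:V\to V^*$ be continuous and strongly monotone with constant $c_{\mathcal A}>0$, i.e. $(\mathcal{A}(v)-\mathcal{A}(w))(v-w)\ge c_{\mathcal A}\|v-w\|_V^2$ for all $v,w\in V$. Suppose that there is $c_J>0$ with $$J^0(y_1;y_2-y_1)+J^0(y_2;y_1-y_2)\le c_J\|y_1-y_2\|_X^2\qquad\forall y_1,y_2\in X,$$ and that $c_J\|\gamma\|_{V\to X}^2<c_{\mathcal A}$. Then there exists a unique $\hat v\in\mathrm{dom}\,F$ such that $$\mathcal{A}(\hat v)(v-\hat v)+J^0(\gamma\hat v;\gamma v-\gamma\hat v)+F(v)-F(\hat v)\ge 0\qquad\forall v\in V.$$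
   Context: For a locally Lipschitz $J:X\to\mathbb{R}$ the (Clarke) generalized directional derivative is $J^0(x;z):=\limsup_{y\to x,\,t\downarrow 0}\frac{J(y+tz)-J(y)}{t}$. The effective domain is $\mathrm{dom}\,F:=\{v\in V:F(v)<+\infty\}$; proper means $\mathrm{dom}\,F\ne\emptyset$. *)

theory Defs
  imports "HOL-Analysis.Analysis"
begin

text \<open>Reflexivity: the canonical embedding of the space into its bidual is onto.
  The (strong) dual of \<open>'v\<close> is the type \<open>'v \<Rightarrow>\<^sub>L real\<close>, normed by the operator norm.\<close>

definition canonical_embedding ::
    "'v::real_normed_vector \<Rightarrow> (('v \<Rightarrow>\<^sub>L real) \<Rightarrow>\<^sub>L real)"
  where "canonical_embedding v = Blinfun (\<lambda>f. blinfun_apply f v)"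

lemma canonical_embedding_apply [simp]:
  "blinfun_apply (canonical_embedding v) f = blinfun_apply f v"
  unfolding canonical_embedding_def
  by (simp add: bounded_linear_Blinfun_apply blinfun.bounded_linear_left)

definition reflexive_space :: "'v::real_normed_vector itself \<Rightarrow> bool"
  where "reflexive_space (_ :: 'v itself) \<longleftrightarrow>
    surj (canonical_embedding :: 'v \<Rightarrow> (('v \<Rightarrow>\<^sub>L real) \<Rightarrow>\<^sub>L real))"

definition locally_lipschitz :: "('x::metric_space \<Rightarrow> real) \<Rightarrow> bool"
  where "locally_lipschitz J \<longleftrightarrow>
    (\<forall>x. \<exists>U L. open U \<and> x \<in> U \<and> L-lipschitz_on U J)"

text \<open>The limit superior is taken in the extended reals, so that it always makes sense; for locally
  Lipschitz \<open>J\<close> it is finite (lemma \<open>clarke_derivative_finite\<close>). The filter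
  \<open>nhds x \<times>\<^sub>F at_right 0\<close> is the joint limit \<open>y \<rightarrow> x\<close> (with \<open>y = x\<close> allowed), \<open>t \<down> 0\<close>.\<close>

definition clarke_derivative :: "('x::real_normed_vector \<Rightarrow> real) \<Rightarrow> 'x \<Rightarrow> 'x \<Rightarrow> ereal"
  where "clarke_derivative J x z =
    Limsup (nhds x \<times>\<^sub>F at_right 0) (\<lambda>(y, t). ereal ((J (y + t *\<^sub>R z) - J y) / t))"

definition strongly_monotone :: "('v::real_normed_vector \<Rightarrow> ('v \<Rightarrow>\<^sub>L real)) \<Rightarrow> real \<Rightarrow> bool"
  where "strongly_monotone A c \<longleftrightarrow>
    (\<forall>v w. blinfun_apply (A v - A w) (v - w) \<ge> c * (norm (v - w))\<^sup>2)"

definition effective_domain :: "('v \<Rightarrow> ereal) \<Rightarrow> 'v set"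
  where "effective_domain F = {v. F v < \<infinity>}"

definition proper_function :: "('v \<Rightarrow> ereal) \<Rightarrow> bool"
  where "proper_function F \<longleftrightarrow> effective_domain F \<noteq> {}"

text \<open>Convexity and lower semicontinuity are meant for functions that never take the value
  \<open>-\<infinity>\<close>; note that \<open>0 * \<infinity> = 0\<close> in \<^typ>\<open>ereal\<close>, which makes the endpoints \<open>t = 0, 1\<close> harmless.\<close>

definition convex_function :: "('v::real_vector \<Rightarrow> ereal) \<Rightarrow> bool"
  where "convex_function F \<longleftrightarrow>
    (\<forall>v w. \<forall>t\<in>{0..1::real}.
       F ((1 - t) *\<^sub>R v + t *\<^sub>R w) \<le> ereal (1 - t) * F v + ereal t * F w)"

definition lower_semicontinuous :: "('v::topological_space \<Rightarrow> ereal) \<Rightarrow> bool"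
  where "lower_semicontinuous F \<longleftrightarrow> (\<forall>v. F v \<le> Liminf (nhds v) F)"

lemma clarke_derivative_finite:
  fixes J :: "'x::real_normed_vector \<Rightarrow> real"
  assumes "locally_lipschitz J"
  shows "\<bar>clarke_derivative J x z\<bar> \<noteq> \<infinity>"
proof -
  obtain U L where U: "open U" "x \<in> U" "L-lipschitz_on U J"
    using assms unfolding locally_lipschitz_def by blast
  have nontriv: "nhds x \<times>\<^sub>F at_right (0::real) \<noteq> bot"
    by (simp add: prod_filter_eq_bot)
  have "((\<lambda>p. fst p + snd p *\<^sub>R z) \<longlongrightarrow> x + 0 *\<^sub>R z) (nhds x \<times>\<^sub>F at_right (0::real))"
    by (intro tendsto_intros filterlim_fst filterlim_compose[OF _ filterlim_snd] tendsto_ident_at)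
  then have "\<forall>\<^sub>F p in nhds x \<times>\<^sub>F at_right (0::real). fst p + snd p *\<^sub>R z \<in> U"
    using topological_tendstoD U by fastforce
  moreover have "\<forall>\<^sub>F p in nhds x \<times>\<^sub>F at_right (0::real). fst p \<in> U"
    using topological_tendstoD[OF filterlim_fst U(1,2)] .
  moreover have "\<forall>\<^sub>F p in nhds x \<times>\<^sub>F at_right (0::real). snd p > 0"
    by (rule eventually_compose_filterlim[OF _ filterlim_snd]) (simp add: eventually_at_right_less)
  ultimately have bd: "\<forall>\<^sub>F p in nhds x \<times>\<^sub>F at_right (0::real).
      \<bar>(J (fst p + snd p *\<^sub>R z) - J (fst p)) / snd p\<bar> \<le> L * norm z"
  proof eventually_elim
    case (elim p)
    have "\<bar>J (fst p + snd p *\<^sub>R z) - J (fst p)\<bar> \<le> L * (snd p * norm z)"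
      using lipschitz_onD[OF U(3) elim(1,2)] elim(3) by (simp add: dist_norm)
    with elim(3) show ?case by (simp add: abs_divide divide_le_eq algebra_simps)
  qed
  have "clarke_derivative J x z \<le> ereal (L * norm z)"
    unfolding clarke_derivative_def
    by (rule Limsup_bounded) (use bd in eventually_elim, simp add: case_prod_beta abs_le_iff del: abs_divide)
  moreover have "ereal (- (L * norm z)) \<le> Liminf (nhds x \<times>\<^sub>F at_right 0)
      (\<lambda>(y, t). ereal ((J (y + t *\<^sub>R z) - J y) / t))"
    by (rule Liminf_bounded) (use bd in eventually_elim, simp add: case_prod_beta abs_le_iff del: abs_divide)
  then have "ereal (- (L * norm z)) \<le> clarke_derivative J x z"
    unfolding clarke_derivative_def using Liminf_le_Limsup[OF nontriv] order_trans by blast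
  ultimately show ?thesis
    by (cases "clarke_derivative J x z") auto
qed

end

theory Submission
  imports Defs
begin

text \<open>
  Uniqueness: adding the inequalities of two solutions, each tested with the other, the strong
  monotonicity of \<open>A\<close> beats the relaxed monotonicity of \<open>J\<^sup>0\<close>, because \<open>c\<^sub>J * (norm \<gamma>)\<^sup>2 < c\<^sub>A\<close>.

  Existence: the inequality is first solved in Minty's form, with the base point of \<open>A\<close> and of
  \<open>J\<^sup>0\<close> at the test point: find \<open>u\<close> with \<open>\<psi> v u \<le> 0\<close> for all \<open>v\<close> in the domain of \<open>F\<close>, where
  \<open>\<psi> v u = A v (u - v) + J\<^sup>0(\<gamma> v; \<gamma> u - \<gamma> v) + F u - F v + m / 2 * (norm (u - v))\<^sup>2\<close>
  and \<open>m = c\<^sub>A - c\<^sub>J * (norm \<gamma>)\<^sup>2 > 0\<close>. As \<open>J\<^sup>0\<close> is sublinear and continuous in the direction, \<open>\<psi> v\<close> is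
  convex and lower semicontinuous, so its sublevel sets are closed and convex; the quadratic term makes
  them bounded; and the two monotonicity conditions give \<open>\<psi> v w + \<psi> w v \<le> 0\<close>. For finitely
  many test points these properties reduce the problem to finding a probability vector \<open>\<theta>\<close> with
  \<open>M \<theta> \<le> 0\<close> for a matrix \<open>M\<close> with nonpositive symmetric part, which a minimisation over the simplex
  provides (\<open>simplex_solution_nonpositive_symmetric_part\<close>). For all test points at once it then suffices
  that, in a reflexive space, bounded closed convex sets have a common point as soon as any finitely many
  of them do (\<open>reflexive_closed_convex_fip\<close>), which follows from Tychonoff's theorem and the separation of a point from a closed convex set. Both are
  combined in \<open>monotone_equilibrium\<close>.

  Finally \<open>hemivariational_Minty\<close> moves the base points to \<open>u\<close> by testing with points on the segment from
  \<open>u\<close> to \<open>v\<close>, using the continuity of \<open>A\<close> and the upper semicontinuity of \<open>J\<^sup>0\<close> in its base point.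
\<close>

section \<open>Sublinear functionals and the Hahn-Banach theorem\<close>

definition sublinear :: "('a::real_vector \<Rightarrow> real) \<Rightarrow> bool"
  where "sublinear p \<longleftrightarrow>
    (\<forall>x y. p (x + y) \<le> p x + p y) \<and> (\<forall>c\<ge>0. \<forall>x. p (c *\<^sub>R x) = c * p x)"

lemma sublinear_add: "sublinear p \<Longrightarrow> p (x + y) \<le> p x + p y"
  by (simp add: sublinear_def)

lemma sublinear_scaleR: "sublinear p \<Longrightarrow> 0 \<le> c \<Longrightarrow> p (c *\<^sub>R x) = c * p x"
  by (simp add: sublinear_def)

lemma sublinear_0 [simp]: "sublinear p \<Longrightarrow> p 0 = 0"
  using sublinear_scaleR[of p 0 0] by simp

lemma sublinear_minus: "sublinear p \<Longrightarrow> - p (- x) \<le> p x"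
  using sublinear_add[of p x "- x"] by simp

lemma sublinear_norm: "sublinear norm"
  by (simp add: sublinear_def norm_triangle_ineq)

lemma sublinearI:
  assumes add: "\<And>x y. p (x + y) \<le> p x + p y"
    and zero: "p 0 = 0"
    and scale: "\<And>c x. 0 < c \<Longrightarrow> p (c *\<^sub>R x) \<le> c * p x"
  shows "sublinear p"
  unfolding sublinear_def
proof (intro conjI allI impI add)
  fix c :: real and x
  assume "0 \<le> c"
  show "p (c *\<^sub>R x) = c * p x"
  proof (cases "c = 0")
    case False
    with \<open>0 \<le> c\<close> have "0 < c" by simp
    then have "p ((1 / c) *\<^sub>R (c *\<^sub>R x)) \<le> (1 / c) * p (c *\<^sub>R x)"
      by (intro scale) simp
    with \<open>0 < c\<close> have "c * p x \<le> p (c *\<^sub>R x)"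
      by (simp add: field_simps)
    with scale[OF \<open>0 < c\<close>, of x] show ?thesis by linarith
  qed (simp add: zero)
qed

lemma linear_if_sublinear_odd:
  assumes q: "sublinear q" and odd: "\<And>x. q (- x) \<le> - q x"
  shows "linear q"
proof (rule linearI)
  have odd': "q (- x) = - q x" for x
    using odd[of x] sublinear_minus[OF q, of x] by linarith
  show "q (x + y) = q x + q y" for x y
    using sublinear_add[OF q, of x y] sublinear_add[OF q, of "- x" "- y"]
      odd'[of "x + y"] odd'[of x] odd'[of y] by simp
  show "q (c *\<^sub>R x) = c *\<^sub>R q x" for c x
  proof (cases "c \<ge> 0")
    case False
    then have "q ((- c) *\<^sub>R x) = (- c) * q x"
      by (intro sublinear_scaleR[OF q]) simp
    then show ?thesis by (simp add: odd')
  qed (simp add: sublinear_scaleR[OF q])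
qed

text \<open>Each pair \<open>(w, a)\<close> of the cone is a demand on a sublinear functional below \<open>q\<close>: its value at
  \<open>- w\<close> should be at most \<open>- a\<close>. The largest candidate is \<open>r x = inf (q (x + w) - a)\<close>, and \<open>a \<le> q w\<close> is
  exactly what keeps this infimum finite. The ray through \<open>(y, q y)\<close> is used below for Hahn-Banach,
  and the cone spanned by \<open>(e - z, d)\<close> with \<open>e\<close> in a convex set for separation.\<close>

lemma sublinear_infimum_over_cone:
  fixes C :: "('a::real_vector \<times> real) set" and q :: "'a \<Rightarrow> real"
  defines "r \<equiv> \<lambda>x. INF (w, a)\<in>C. q (x + w) - a"
  assumes q: "sublinear q" and C: "convex_cone C"
    and dominated: "\<And>w a. (w, a) \<in> C \<Longrightarrow> a \<le> q w"
  shows "sublinear r" and "r x \<le> q x" and "(w, a) \<in> C \<Longrightarrow> r (- w) \<le> - a"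
proof -
  have zero: "0 \<in> C" using C by (simp add: convex_cone_contains_0)
  have lower: "- q (- x) \<le> q (x + w) - a" if "(w, a) \<in> C" for x w a
    using sublinear_add[OF q, of "x + w" "- x"] dominated[OF that] by simp
  have upper: "r x \<le> q (x + w) - a" if "(w, a) \<in> C" for x w a
  proof -
    have "bdd_below ((\<lambda>(w, a). q (x + w) - a) ` C)"
      using lower by (intro bdd_belowI2[of _ "- q (- x)"]) auto
    from cINF_lower[OF this that] show ?thesis by (simp add: r_def)
  qed
  have greatest: "b \<le> r x" if "\<And>w a. (w, a) \<in> C \<Longrightarrow> b \<le> q (x + w) - a" for b x
    unfolding r_def using zero that by (intro cINF_greatest) auto
  show below: "r x \<le> q x" for x
    using upper[of 0 0 x] zero by (simp add: zero_prod_def)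
  show "r (- w) \<le> - a" if "(w, a) \<in> C"
    using upper[OF that, of "- w"] q by simp
  show "sublinear r"
  proof (rule sublinearI)
    fix x y
    have "r (x + y) \<le> (q (x + w) - a) + (q (y + w') - a')"
      if "(w, a) \<in> C" "(w', a') \<in> C" for w a w' a'
    proof -
      have "(w + w', a + a') \<in> C"
        using convex_cone_add[OF C that] by simp
      from upper[OF this, of "x + y"] show ?thesis
        using sublinear_add[OF q, of "x + w" "y + w'"] by (simp add: algebra_simps)
    qed
    then have "r (x + y) - (q (y + w') - a') \<le> r x" if "(w', a') \<in> C" for w' a'
      using that by (intro greatest) (simp add: algebra_simps)
    then have "r (x + y) - r x \<le> r y"
      by (intro greatest) (simp add: algebra_simps)
    then show "r (x + y) \<le> r x + r y" by simp
  next
    have "0 \<le> r 0" using dominated by (intro greatest) simp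
    with below[of 0] q show "r 0 = 0" by simp
  next
    fix c :: real and x
    assume "0 < c"
    have "r (c *\<^sub>R x) / c \<le> q (x + w) - a" if "(w, a) \<in> C" for w a
    proof -
      have "(c *\<^sub>R w, c * a) \<in> C"
        using convex_cone_scaleR[OF C _ that, of c] \<open>0 < c\<close> by simp
      from upper[OF this, of "c *\<^sub>R x"]
      have "r (c *\<^sub>R x) \<le> q (c *\<^sub>R (x + w)) - c * a" by (simp add: algebra_simps)
      moreover have "q (c *\<^sub>R (x + w)) = c * q (x + w)"
        using \<open>0 < c\<close> by (intro sublinear_scaleR[OF q]) simp
      ultimately have "r (c *\<^sub>R x) \<le> c * (q (x + w) - a)" by (simp add: right_diff_distrib)
      with \<open>0 < c\<close> show ?thesis by (simp add: pos_divide_le_eq mult.commute)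
    qed
    then have "r (c *\<^sub>R x) / c \<le> r x" by (rule greatest)
    with \<open>0 < c\<close> show "r (c *\<^sub>R x) \<le> c * r x" by (simp add: field_simps)
  qed
qed

text \<open>Zorn's lemma: the pointwise infimum of a nonempty chain of sublinear functionals below \<open>p\<close> is finite because
  each of them is at least \<open>- p (- x)\<close>, and it is subadditive because two members of a
  chain can be replaced by the smaller one.\<close>

lemma ex_minimal_sublinear:
  fixes p :: "'a::real_vector \<Rightarrow> real"
  assumes p: "sublinear p"
  shows "\<exists>q. sublinear q \<and> q \<le> p \<and> (\<forall>r. sublinear r \<longrightarrow> r \<le> q \<longrightarrow> r = q)"
proof -
  define S where "S = {q. sublinear q \<and> q \<le> p}"
  have "\<exists>m\<in>S. \<forall>a\<in>S. a \<le> m \<longrightarrow> a = m"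
  proof (rule predicate_Zorn[of S "\<lambda>x y. y \<le> x"])
    show "partial_order_on S (relation_of (\<lambda>x y. y \<le> x) S)"
      by (rule partial_order_on_relation_ofI) auto
  next
    fix C
    assume C: "C \<in> Chains (relation_of (\<lambda>x y. y \<le> x) S)"
    then have CS: "C \<subseteq> S" and tot: "\<And>a b. a \<in> C \<Longrightarrow> b \<in> C \<Longrightarrow> a \<le> b \<or> b \<le> a"
      by (auto simp: Chains_def relation_of_def)
    show "\<exists>u\<in>S. \<forall>a\<in>C. u \<le> a"
    proof (cases "C = {}")
      case True
      with p show ?thesis by (auto simp: S_def)
    next
      case False
      define u where "u = (\<lambda>x. INF q\<in>C. q x)"
      have sub: "sublinear q" "q \<le> p" if "q \<in> C" for q
        using CS that by (auto simp: S_def)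
      have lower: "- p (- x) \<le> q x" if "q \<in> C" for q x
        using sublinear_minus[OF sub(1)[OF that], of x] sub(2)[OF that]
        by (smt (verit) le_funD)
      have upper: "u x \<le> q x" if "q \<in> C" for q x
        unfolding u_def using lower that
        by (intro cINF_lower bdd_belowI2[of _ "- p (- x)"]) auto
      have greatest: "b \<le> u x" if "\<And>q. q \<in> C \<Longrightarrow> b \<le> q x" for b x
        unfolding u_def using False that by (intro cINF_greatest) auto
      have "sublinear u"
      proof (rule sublinearI)
        fix x y
        have "u (x + y) \<le> q x + q' y" if "q \<in> C" "q' \<in> C" for q q'
          using tot[OF that]
        proof
          assume "q \<le> q'"
          then show ?thesis
            using upper[OF that(1), of "x + y"] sublinear_add[OF sub(1)[OF that(1)], of x y]
            by (smt (verit) le_funD)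
        next
          assume "q' \<le> q"
          then show ?thesis
            using upper[OF that(2), of "x + y"] sublinear_add[OF sub(1)[OF that(2)], of x y]
            by (smt (verit) le_funD)
        qed
        then have "u (x + y) - q' y \<le> u x" if "q' \<in> C" for q'
          using that by (intro greatest) (simp add: algebra_simps)
        then have "u (x + y) - u x \<le> u y"
          by (intro greatest) (simp add: algebra_simps)
        then show "u (x + y) \<le> u x + u y" by simp
      next
        have "q 0 = 0" if "q \<in> C" for q using sub(1)[OF that] by simp
        then have "(\<lambda>q. q 0) ` C = {0}" using False by force
        then show "u 0 = 0" by (simp add: u_def)
      next
        fix c :: real and x
        assume "0 < c"
        have "u (c *\<^sub>R x) / c \<le> q x" if "q \<in> C" for q
          using upper[OF that, of "c *\<^sub>R x"] sublinear_scaleR[OF sub(1)[OF that], of c x] \<open>0 < c\<close>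
          by (simp add: field_simps)
        then have "u (c *\<^sub>R x) / c \<le> u x" by (rule greatest)
        with \<open>0 < c\<close> show "u (c *\<^sub>R x) \<le> c * u x" by (simp add: field_simps)
      qed
      moreover have "u \<le> p"
      proof (rule le_funI)
        fix x
        obtain q where "q \<in> C" using False by auto
        then show "u x \<le> p x" using upper[of q x] sub(2)[of q] by (auto dest: le_funD intro: order_trans)
      qed
      ultimately show ?thesis using upper by (auto simp: S_def le_fun_def)
    qed
  qed
  then show ?thesis by (force simp: S_def)
qed

text \<open>A minimal sublinear functional is already linear. If \<open>q\<close> is minimal, lowering it along the ray
  through \<open>(y, q y)\<close> cannot change it, although the lowered functional is at most \<open>- q y\<close> at
  \<open>- y\<close>; so \<open>q\<close> is odd.\<close>

theorem Hahn_Banach_sublinear: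
  fixes p :: "'a::real_vector \<Rightarrow> real"
  assumes "sublinear p"
  shows "\<exists>f. linear f \<and> (\<forall>x. f x \<le> p x)"
proof -
  obtain q where q: "sublinear q" "q \<le> p"
    and minimal: "\<And>r. sublinear r \<Longrightarrow> r \<le> q \<Longrightarrow> r = q"
    using ex_minimal_sublinear[OF assms] by blast
  have "q (- y) \<le> - q y" for y
  proof -
    define C where "C = {(t *\<^sub>R y, t * q y) | t. 0 \<le> t}"
    have C: "convex_cone C"
      unfolding convex_cone_iff
    proof (intro conjI ballI allI impI)
      show "0 \<in> C" unfolding C_def by (auto intro!: exI[of _ 0] simp: zero_prod_def)
    next
      fix u v assume "u \<in> C" "v \<in> C"
      then obtain s t where "u = (s *\<^sub>R y, s * q y)" "v = (t *\<^sub>R y, t * q y)" "0 \<le> s" "0 \<le> t"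
        unfolding C_def by blast
      then show "u + v \<in> C" unfolding C_def
        by (auto intro!: exI[of _ "s + t"] simp: algebra_simps)
    next
      fix u and c :: real assume "u \<in> C" "0 \<le> c"
      then obtain s where "u = (s *\<^sub>R y, s * q y)" "0 \<le> s"
        unfolding C_def by blast
      with \<open>0 \<le> c\<close> show "c *\<^sub>R u \<in> C" unfolding C_def
        by (auto intro!: exI[of _ "c * s"])
    qed
    have dom: "a \<le> q w" if "(w, a) \<in> C" for w a
      using that by (auto simp: C_def sublinear_scaleR[OF q(1)])
    have "(y, q y) \<in> C"
      unfolding C_def by (auto intro!: exI[of _ 1])
    note r = sublinear_infimum_over_cone[OF q(1) C dom]
    have "(\<lambda>x. INF (w, a)\<in>C. q (x + w) - a) = q"
      using r(1,2) by (intro minimal) (auto simp: le_fun_def)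
    with r(3)[OF _ \<open>(y, q y) \<in> C\<close>] show "q (- y) \<le> - q y"
      by metis
  qed
  then have "linear q" by (rule linear_if_sublinear_odd[OF q(1)])
  with q(2) show ?thesis by (auto simp: le_fun_def)
qed

text \<open>If \<open>d\<close> is a lower bound for the distance from \<open>z\<close> to \<open>E\<close>, then \<open>t * d \<le> norm (t *\<^sub>R (e - z))\<close>, so
  the norm can be lowered over the cone spanned by the pairs \<open>(e - z, d)\<close>. A linear functional
  below the result is bounded, being below the norm, and is at least \<open>d\<close> on \<open>E - z\<close>.\<close>

theorem separate_point_closed_convex:
  fixes E :: "'a::real_normed_vector set"
  assumes "closed E" "convex E" "z \<notin> E"
  shows "\<exists>f :: 'a \<Rightarrow>\<^sub>L real. \<exists>d>0. \<forall>e\<in>E. blinfun_apply f z + d \<le> blinfun_apply f e"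
proof -
  obtain d where d: "d > 0" "\<And>e. e \<in> E \<Longrightarrow> d \<le> dist z e"
  proof -
    have "open (- E)" "z \<in> - E" using assms(1,3) by auto
    then obtain d where "d > 0" "ball z d \<subseteq> - E" by (rule openE)
    then show ?thesis by (intro that[of d]) (auto simp: subset_iff not_less[symmetric])
  qed
  define C where "C = {(t *\<^sub>R (e - z), t * d) | t e. 0 \<le> t \<and> e \<in> E} \<union> {0}"
  have mem: "(t *\<^sub>R (e - z), t * d) \<in> C" if "0 \<le> t" "e \<in> E" for t e
    unfolding C_def using that by blast
  have C: "convex_cone C"
    unfolding convex_cone_iff
  proof (intro conjI ballI allI impI)
    show "0 \<in> C" unfolding C_def by blast
  next
    fix u v assume uv: "u \<in> C" "v \<in> C"
    show "u + v \<in> C"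
    proof (cases "u = 0 \<or> v = 0")
      case False
      then obtain s e t e' where u: "u = (s *\<^sub>R (e - z), s * d)" "0 \<le> s" "e \<in> E"
        and v: "v = (t *\<^sub>R (e' - z), t * d)" "0 \<le> t" "e' \<in> E"
        using uv unfolding C_def by blast
      \<comment> \<open>Elements of the form \<open>t *\<^sub>R (e - z)\<close> with \<open>t = 0\<close> are the zero element of the cone.\<close>
      have "s \<noteq> 0" using False u by (auto simp: zero_prod_def)
      with u v have st: "0 < s + t" by simp
      have "(s / (s + t)) *\<^sub>R e + (t / (s + t)) *\<^sub>R e' \<in> E"
        using u v st by (intro convexD[OF assms(2)]) (auto simp: add_divide_distrib[symmetric])
      from mem[OF _ this, of "s + t"] st
      have "((s + t) *\<^sub>R ((s / (s + t)) *\<^sub>R e + (t / (s + t)) *\<^sub>R e' - z), (s + t) * d) \<in> C" by simp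
      moreover have "(s + t) *\<^sub>R ((s / (s + t)) *\<^sub>R e + (t / (s + t)) *\<^sub>R e' - z)
          = s *\<^sub>R (e - z) + t *\<^sub>R (e' - z)"
        using st by (simp add: scaleR_right_diff_distrib scaleR_right_distrib scaleR_left_distrib)
      ultimately show ?thesis using u v by (simp add: algebra_simps)
    qed (use uv in auto)
  next
    fix u and c :: real assume "u \<in> C" "0 \<le> c"
    then consider "u = 0" | s e where "u = (s *\<^sub>R (e - z), s * d)" "0 \<le> s" "e \<in> E"
      unfolding C_def by blast
    then show "c *\<^sub>R u \<in> C"
    proof cases
      case 2
      with \<open>0 \<le> c\<close> mem[of "c * s" e] show ?thesis by (simp add: mult.assoc)
    qed (simp add: C_def)
  qed
  have dom: "a \<le> norm w" if "(w, a) \<in> C" for w a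
  proof -
    have "t * d \<le> t * norm (e - z)" if "0 \<le> t" "e \<in> E" for t e
      using d(2)[OF that(2)] that(1) by (intro mult_left_mono) (simp_all add: dist_norm norm_minus_commute)
    with that show ?thesis unfolding C_def by (auto simp: zero_prod_def)
  qed
  note r = sublinear_infimum_over_cone[OF sublinear_norm C dom]
  obtain f where f: "linear f" "\<And>x. f x \<le> (INF (w, a)\<in>C. norm (x + w) - a)"
    using Hahn_Banach_sublinear[OF r(1)] by blast
  have "f x \<le> norm x" for x using f(2) r(2) order_trans by blast
  from this this[of "- x" for x] have "\<bar>f x\<bar> \<le> norm x" for x
    using linear_neg[OF f(1), of x] by (smt (verit) norm_minus_cancel)
  then have "bounded_linear f"
    using f(1) by (intro linear_conv_bounded_linear[THEN iffD1] bounded_linear_intro[of _ 1])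
      (auto simp: linear_add linear_scale)
  moreover have "f z + d \<le> f e" if "e \<in> E" for e
  proof -
    have "f (- (e - z)) \<le> - d"
      using f(2) r(3)[of "e - z" d] mem[OF _ that, of 1] order_trans by fastforce
    then show ?thesis using f(1) by (simp add: linear_diff)
  qed
  ultimately show ?thesis using d(1)
    by (intro exI[of _ "Blinfun f"]) (auto simp: bounded_linear_Blinfun_apply)
qed

section \<open>Compactness in reflexive spaces and monotone equilibrium problems\<close>

lemma compact_bounded_functions:
  fixes b :: "'i \<Rightarrow> real"
  shows "compact {\<xi>. \<forall>i. \<bar>\<xi> i\<bar> \<le> b i}"
proof -
  have "compactin (product_topology (\<lambda>i. euclidean) UNIV) (PiE UNIV (\<lambda>i. {- b i..b i}))"
    by (subst compactin_PiE) simp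
  moreover have "PiE UNIV (\<lambda>i. {- b i..b i}) = {\<xi>. \<forall>i. \<bar>\<xi> i\<bar> \<le> b i}"
    by (auto simp: abs_le_iff minus_le_iff)
  ultimately show ?thesis by (simp add: euclidean_product_topology)
qed

text \<open>Weak compactness in the form needed here. A point of the intersection is looked for as a functional
  \<open>\<xi>\<close> on the dual, in the compact product of the intervals \<open>[- R * norm f, R * norm f]\<close>.
  Linearity (\<open>L\<close>) and the half-space bounds inherited from a set (\<open>H C\<close>) are closed conditions
  on \<open>\<xi>\<close>, and evaluation at a common point of finitely many sets satisfies the
  corresponding conditions. Reflexivity turns \<open>\<xi>\<close> into a point \<open>u\<close>, and if \<open>u\<close> were outside
  \<open>C\<close>, a separating functional would violate \<open>H C\<close>.\<close>

theorem reflexive_closed_convex_fip: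
  fixes \<C> :: "'v::real_normed_vector set set"
  assumes refl: "reflexive_space TYPE('v)"
    and closed: "\<And>C. C \<in> \<C> \<Longrightarrow> closed C" and conv: "\<And>C. C \<in> \<C> \<Longrightarrow> convex C"
    and bounded: "C0 \<in> \<C>" "bounded C0"
    and fip: "\<And>\<F>. finite \<F> \<Longrightarrow> \<F> \<subseteq> \<C> \<Longrightarrow> \<Inter>\<F> \<noteq> {}"
  shows "\<Inter>\<C> \<noteq> {}"
proof -
  obtain R where R: "\<And>x. x \<in> C0 \<Longrightarrow> norm x \<le> R"
    using bounded(2) by (auto simp: bounded_iff)
  define K where "K = {\<xi> :: ('v \<Rightarrow>\<^sub>L real) \<Rightarrow> real. \<forall>f. \<bar>\<xi> f\<bar> \<le> R * norm f}"
  define L where "L = {\<xi> :: ('v \<Rightarrow>\<^sub>L real) \<Rightarrow> real. \<forall>f g c. \<xi> (f + g) = \<xi> f + \<xi> g \<and> \<xi> (c *\<^sub>R f) = c * \<xi> f}"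
  define H where "H = (\<lambda>C. {\<xi> :: ('v \<Rightarrow>\<^sub>L real) \<Rightarrow> real. \<forall>f b. (\<forall>x\<in>C. b \<le> blinfun_apply f x) \<longrightarrow> b \<le> \<xi> f})"
  have "K \<inter> \<Inter>(insert L (H ` \<C>)) \<noteq> {}"
  proof (rule compact_imp_fip)
    show "compact K"
      unfolding K_def by (rule compact_bounded_functions)
    fix T assume "T \<in> insert L (H ` \<C>)"
    moreover have "closed L"
      unfolding L_def
      by (intro closed_Collect_all closed_Collect_conj closed_Collect_eq continuous_intros
          continuous_on_product_coordinates)
    moreover have "closed (H C)" for C
      unfolding H_def
      by (intro closed_Collect_all closed_Collect_imp closed_Collect_le open_Collect_const continuous_intros
          continuous_on_product_coordinates)
    ultimately show "closed T" by auto
  next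
    fix \<T> assume \<T>: "finite \<T>" "\<T> \<subseteq> insert L (H ` \<C>)"
    then obtain \<F> where \<F>: "finite \<F>" "\<F> \<subseteq> \<C>" "\<T> - {L} \<subseteq> H ` \<F>"
      by (metis Diff_subset_conv finite_Diff finite_subset_image insert_is_Un subset_refl)
    then have "\<Inter>(insert C0 \<F>) \<noteq> {}"
      using bounded(1) by (intro fip) auto
    then obtain x where x: "x \<in> C0" "\<And>C. C \<in> \<F> \<Longrightarrow> x \<in> C" by auto
    let ?ev = "\<lambda>f. blinfun_apply f x"
    have "\<bar>?ev f\<bar> \<le> R * norm f" for f
    proof -
      have "norm f * norm x \<le> norm f * R" using R[OF x(1)] by (intro mult_left_mono) auto
      with norm_blinfun[of f x] show ?thesis by (simp add: mult.commute)
    qed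
    then have "?ev \<in> K" by (simp add: K_def)
    moreover have "?ev \<in> L" by (simp add: L_def blinfun.add_left blinfun.scaleR_left)
    moreover have "?ev \<in> H C" if "C \<in> \<F>" for C using x(2)[OF that] by (auto simp: H_def)
    ultimately have "?ev \<in> K \<inter> \<Inter>\<T>" using \<F>(3) by blast
    then show "K \<inter> \<Inter>\<T> \<noteq> {}" by blast
  qed
  then obtain \<xi> where \<xi>: "\<xi> \<in> K" "\<xi> \<in> L" "\<And>C. C \<in> \<C> \<Longrightarrow> \<xi> \<in> H C" by auto
  have "bounded_linear \<xi>"
    using \<xi>(1,2) by (intro bounded_linear_intro[of _ R]) (auto simp: K_def L_def mult.commute)
  then obtain u where "canonical_embedding u = Blinfun \<xi>"
    using refl unfolding reflexive_space_def surj_def by metis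
  then have u: "\<xi> f = blinfun_apply f u" for f
    using \<open>bounded_linear \<xi>\<close> by (metis bounded_linear_Blinfun_apply canonical_embedding_apply)
  have "u \<in> C" if C: "C \<in> \<C>" for C
  proof (rule ccontr)
    assume "u \<notin> C"
    then obtain f :: "'v \<Rightarrow>\<^sub>L real" and d where "d > 0" "\<forall>x\<in>C. blinfun_apply f u + d \<le> blinfun_apply f x"
      using separate_point_closed_convex[OF closed[OF C] conv[OF C]] by blast
    moreover have "blinfun_apply f u + d \<le> \<xi> f"
      using \<xi>(3)[OF C] calculation(2) unfolding H_def by blast
    ultimately show False by (simp add: u)
  qed
  then show ?thesis by blast
qed

text \<open>The minimax theorem for a matrix whose symmetric part is nonpositive: the mixed strategy \<open>\<theta>\<close> is
  good against every row. Minimise over the simplex the sum of squares of the positive parts \<open>w\<close> of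
  the entries of \<open>M \<theta>\<close>. If \<open>w\<close> were not zero, moving \<open>\<theta>\<close> towards the normalised \<open>w\<close>
  would decrease this sum to first order, since \<open>w\<^sup>T M w \<le> 0 < w\<^sup>T M \<theta>\<close>.\<close>

lemma simplex_solution_nonpositive_symmetric_part:
  fixes M :: "'i \<Rightarrow> 'i \<Rightarrow> real"
  assumes S: "finite S" "S \<noteq> {}"
    and M: "\<And>i j. i \<in> S \<Longrightarrow> j \<in> S \<Longrightarrow> M i j + M j i \<le> 0"
  shows "\<exists>\<theta>. (\<forall>j\<in>S. 0 \<le> \<theta> j) \<and> (\<Sum>j\<in>S. \<theta> j) = 1 \<and> (\<forall>i\<in>S. (\<Sum>j\<in>S. \<theta> j * M i j) \<le> 0)"
proof -
  define \<Delta> where "\<Delta> = {\<theta> :: 'i \<Rightarrow> real. (\<forall>j. \<bar>\<theta> j\<bar> \<le> 1) \<and> (\<forall>j. 0 \<le> \<theta> j) \<and> (\<Sum>j\<in>S. \<theta> j) = 1}"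
  define P where "P = (\<lambda>\<theta> i. \<Sum>j\<in>S. \<theta> j * M i j)"
  define H where "H = (\<lambda>\<theta>. \<Sum>i\<in>S. (max 0 (P \<theta> i))\<^sup>2)"
  have coord: "continuous_on UNIV (\<lambda>\<theta> :: 'i \<Rightarrow> real. \<theta> j)" for j
    by (rule continuous_on_product_coordinates)
  have "compact \<Delta>"
  proof -
    have "closed {\<theta> :: 'i \<Rightarrow> real. (\<forall>j. 0 \<le> \<theta> j) \<and> (\<Sum>j\<in>S. \<theta> j) = 1}"
      by (intro closed_Collect_all closed_Collect_conj closed_Collect_eq closed_Collect_le
          continuous_intros coord)
    with compact_bounded_functions[of "\<lambda>_. 1"] have
      "compact ({\<theta> :: 'i \<Rightarrow> real. \<forall>j. \<bar>\<theta> j\<bar> \<le> 1} \<inter> {\<theta>. (\<forall>j. 0 \<le> \<theta> j) \<and> (\<Sum>j\<in>S. \<theta> j) = 1})"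
      by (rule compact_Int_closed)
    then show ?thesis by (simp add: \<Delta>_def Collect_conj_eq)
  qed
  moreover have "\<Delta> \<noteq> {}"
  proof -
    obtain k where "k \<in> S" using S by auto
    then have "(\<lambda>j. if j = k then 1 else 0) \<in> \<Delta>" using S by (simp add: \<Delta>_def)
    then show ?thesis by blast
  qed
  moreover have "continuous_on UNIV H"
    unfolding H_def P_def by (intro continuous_intros coord)
  then have "continuous_on \<Delta> H" by (rule continuous_on_subset) simp
  ultimately obtain \<theta> where \<theta>: "\<theta> \<in> \<Delta>" "\<And>\<mu>. \<mu> \<in> \<Delta> \<Longrightarrow> H \<theta> \<le> H \<mu>"
    using continuous_attains_inf[of \<Delta> H] by blast
  define w where "w = (\<lambda>i. max 0 (P \<theta> i))"
  define W where "W = (\<Sum>i\<in>S. w i)"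
  have w0: "0 \<le> w i" for i by (simp add: w_def)
  have Hw: "H \<theta> = (\<Sum>i\<in>S. (w i)\<^sup>2)" by (simp add: H_def w_def)
  have "W \<le> 0"
  proof (rule ccontr)
    assume "\<not> W \<le> 0"
    then have W: "0 < W" by simp
    define \<mu> where "\<mu> = (\<lambda>j. if j \<in> S then w j / W else 0)"
    have wW: "w j \<le> W" if "j \<in> S" for j
      unfolding W_def using S(1) that w0 by (intro member_le_sum) auto
    have \<mu>: "\<mu> \<in> \<Delta>"
      using W w0 wW by (auto simp: \<Delta>_def \<mu>_def W_def[symmetric] sum_divide_distrib[symmetric])
    \<comment> \<open>The quadratic form of \<open>M\<close> only sees the symmetric part, which is nonpositive.\<close>
    have wPw: "(\<Sum>i\<in>S. w i * P w i) \<le> 0"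
    proof -
      let ?s = "\<Sum>i\<in>S. \<Sum>j\<in>S. w i * w j * M i j"
      have "?s = (\<Sum>i\<in>S. \<Sum>j\<in>S. w i * w j * M j i)"
        by (subst sum.swap) (simp add: mult.commute)
      then have "?s + ?s = (\<Sum>i\<in>S. \<Sum>j\<in>S. w i * w j * (M i j + M j i))"
        by (simp add: sum.distrib distrib_left)
      also have "\<dots> \<le> 0"
        using w0 M by (intro sum_nonpos mult_nonneg_nonpos mult_nonneg_nonneg) auto
      finally have "?s \<le> 0" by linarith
      then show ?thesis by (simp add: P_def sum_distrib_left mult.assoc)
    qed
    have P\<mu>: "P \<mu> i = P w i / W" for i
      by (simp add: P_def \<mu>_def sum_divide_distrib)
    \<comment> \<open>This is half of the derivative of \<open>H\<close> at \<open>\<theta>\<close> in the direction \<open>\<mu> - \<theta>\<close>.\<close>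
    have dir: "(\<Sum>i\<in>S. w i * (P \<mu> i - P \<theta> i)) \<le> - H \<theta>"
    proof -
      have "(\<Sum>i\<in>S. w i * P \<mu> i) = (\<Sum>i\<in>S. w i * P w i) / W"
        by (simp add: P\<mu> sum_divide_distrib)
      then have "(\<Sum>i\<in>S. w i * P \<mu> i) \<le> 0"
        using wPw W by (simp add: divide_nonpos_pos)
      moreover have "(\<Sum>i\<in>S. w i * P \<theta> i) = H \<theta>"
        unfolding Hw by (intro sum.cong) (auto simp: w_def max_def power2_eq_square)
      ultimately show ?thesis by (simp add: right_diff_distrib sum_subtractf)
    qed
    define Q where "Q = (\<Sum>i\<in>S. (P \<mu> i - P \<theta> i)\<^sup>2)"
    have sq: "(max 0 (x + h))\<^sup>2 \<le> (max 0 x)\<^sup>2 + 2 * max 0 x * h + h\<^sup>2" for x h :: real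
    proof -
      have "0 \<le> max 0 (x + h)" "max 0 (x + h) \<le> \<bar>max 0 x + h\<bar>" by auto
      then have "(max 0 (x + h))\<^sup>2 \<le> \<bar>max 0 x + h\<bar>\<^sup>2" by (rule power_mono[rotated])
      then show ?thesis by (simp add: power2_sum)
    qed
    have step: "2 * H \<theta> \<le> t * Q" if t: "0 < t" "t \<le> 1" for t
    proof -
      define \<nu> where "\<nu> = (\<lambda>j. (1 - t) * \<theta> j + t * \<mu> j)"
      have "\<nu> \<in> \<Delta>"
      proof -
        have nonneg: "0 \<le> \<nu> j" for j using \<theta>(1) \<mu> t by (simp add: \<nu>_def \<Delta>_def)
        have le1: "\<nu> j \<le> 1" for j
          unfolding \<nu>_def using \<theta>(1) \<mu> t
          by (intro convex_bound_le) (auto simp: \<Delta>_def abs_le_iff)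
        from nonneg le1 have "\<bar>\<nu> j\<bar> \<le> 1" for j by (simp add: abs_le_iff order_trans[of _ 0])
        with nonneg show ?thesis using \<theta>(1) \<mu>
          by (simp add: \<Delta>_def \<nu>_def sum.distrib sum_distrib_left[symmetric])
      qed
      have P\<nu>: "P \<nu> i = P \<theta> i + t * (P \<mu> i - P \<theta> i)" for i
        by (simp add: P_def \<nu>_def sum.distrib sum_distrib_left sum_subtractf algebra_simps)
      have "H \<theta> \<le> H \<nu>" using \<theta>(2) \<open>\<nu> \<in> \<Delta>\<close> by blast
      also have "\<dots> \<le> (\<Sum>i\<in>S. (w i)\<^sup>2 + 2 * w i * (t * (P \<mu> i - P \<theta> i)) + (t * (P \<mu> i - P \<theta> i))\<^sup>2)"
        unfolding H_def P\<nu> w_def by (intro sum_mono sq)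
      also have "\<dots> = H \<theta> + 2 * t * (\<Sum>i\<in>S. w i * (P \<mu> i - P \<theta> i)) + t\<^sup>2 * Q"
        by (simp add: Hw Q_def sum.distrib sum_distrib_left power_mult_distrib mult_ac)
      also have "\<dots> \<le> H \<theta> + 2 * t * (- H \<theta>) + t\<^sup>2 * Q"
        using dir t by (intro add_mono mult_left_mono) auto
      finally have "t * (2 * H \<theta>) \<le> t * (t * Q)" by (simp add: power2_eq_square)
      then show ?thesis using t(1) by simp
    qed
    have "((\<lambda>t. t * Q) \<longlongrightarrow> 0 * Q) (at_right 0)" by (intro tendsto_intros)
    moreover have "\<forall>\<^sub>F t in at_right 0. 2 * H \<theta> \<le> t * Q"
      using step unfolding eventually_at_right_field by (intro exI[of _ 1]) auto
    ultimately have "2 * H \<theta> \<le> 0 * Q"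
      by (intro tendsto_lowerbound) auto
    then have "H \<theta> = 0" using sum_nonneg[of S "\<lambda>i. (w i)\<^sup>2"] by (simp add: Hw)
    then have "\<forall>i\<in>S. w i = 0" using S(1) by (simp add: Hw sum_nonneg_eq_0_iff)
    then have "W = 0" by (simp add: W_def)
    with W show False by simp
  qed
  moreover have "w i \<le> W" if "i \<in> S" for i
    unfolding W_def using S(1) that w0 by (intro member_le_sum) auto
  ultimately have "P \<theta> i \<le> 0" if "i \<in> S" for i
    using that by (fastforce simp: w_def)
  with \<theta>(1) show ?thesis by (intro exI[of _ \<theta>]) (auto simp: \<Delta>_def P_def)
qed

text \<open>For finitely many \<open>v\<close> the inequalities \<open>\<psi> v u \<le> 0\<close> have a common solution among the convex
  combinations of these \<open>v\<close>: by convexity of \<open>\<psi> v\<close> it suffices to find weights for the matrix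
  \<open>\<psi> v w\<close>, and monotonicity says that its symmetric part is nonpositive. Weak compactness passes
  from finitely many \<open>v\<close> to all of them. What makes both steps work is Minty's form of the inequalities, where \<open>u\<close>
  enters only through a convex function.\<close>

theorem monotone_equilibrium:
  fixes \<psi> :: "'v::real_normed_vector \<Rightarrow> 'v \<Rightarrow> real"
  assumes refl: "reflexive_space TYPE('v)"
    and conv: "\<And>v. v \<in> D \<Longrightarrow> convex_on D (\<psi> v)"
    and mono: "\<And>v w. v \<in> D \<Longrightarrow> w \<in> D \<Longrightarrow> \<psi> v w + \<psi> w v \<le> 0"
    and closed: "\<And>v. v \<in> D \<Longrightarrow> closed {u\<in>D. \<psi> v u \<le> 0}"
    and bounded: "v0 \<in> D" "bounded {u\<in>D. \<psi> v0 u \<le> 0}"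
  shows "\<exists>u\<in>D. \<forall>v\<in>D. \<psi> v u \<le> 0"
proof -
  define C where "C = (\<lambda>v. {u\<in>D. \<psi> v u \<le> 0})"
  have "\<Inter>(C ` D) \<noteq> {}"
  proof (rule reflexive_closed_convex_fip[OF refl])
    show "C v0 \<in> C ` D" "bounded (C v0)" using bounded by (auto simp: C_def)
  next
    fix T assume "T \<in> C ` D"
    then obtain v where v: "v \<in> D" "T = C v" by blast
    then show "closed T" using closed by (simp add: C_def)
    show "convex T"
      unfolding v(2) C_def
    proof (rule convexI, safe)
      fix x y and s t :: real
      assume *: "x \<in> D" "y \<in> D" "\<psi> v x \<le> 0" "\<psi> v y \<le> 0" "0 \<le> s" "0 \<le> t" "s + t = 1"
      show "s *\<^sub>R x + t *\<^sub>R y \<in> D"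
        using * convex_on_imp_convex[OF conv[OF v(1)]] by (intro convexD) auto
      have "\<psi> v (s *\<^sub>R x + t *\<^sub>R y) \<le> s * \<psi> v x + t * \<psi> v y"
        using * conv[OF v(1)] by (simp add: convex_on_def)
      also have "\<dots> \<le> 0"
        using * by (simp add: add_nonpos_nonpos mult_nonneg_nonpos)
      finally show "\<psi> v (s *\<^sub>R x + t *\<^sub>R y) \<le> 0" .
    qed
  next
    fix \<F> assume "finite \<F>" "\<F> \<subseteq> C ` D"
    then obtain S0 where S0: "finite S0" "S0 \<subseteq> D" "\<F> = C ` S0"
      by (meson finite_subset_image)
    define S where "S = insert v0 S0"
    have S: "finite S" "S \<noteq> {}" "S \<subseteq> D" using S0 bounded(1) by (auto simp: S_def)
    obtain \<theta> where \<theta>: "\<And>j. j \<in> S \<Longrightarrow> 0 \<le> \<theta> j" "(\<Sum>j\<in>S. \<theta> j) = 1"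
      "\<And>i. i \<in> S \<Longrightarrow> (\<Sum>j\<in>S. \<theta> j * \<psi> i j) \<le> 0"
      using simplex_solution_nonpositive_symmetric_part[of S \<psi>] S mono by (metis subsetD)
    define u where "u = (\<Sum>j\<in>S. \<theta> j *\<^sub>R j)"
    have "u \<in> D"
      unfolding u_def using S \<theta>(1,2) convex_on_imp_convex[OF conv[OF bounded(1)]]
      by (intro convex_sum) auto
    moreover have "\<psi> i u \<le> 0" if "i \<in> S" for i
    proof -
      have "\<psi> i u \<le> (\<Sum>j\<in>S. \<theta> j * \<psi> i j)"
        unfolding u_def using S that \<theta>(1,2) by (intro convex_on_sum[OF _ _ conv]) auto
      with \<theta>(3)[OF that] show ?thesis by linarith
    qed
    ultimately have "u \<in> \<Inter>\<F>" by (auto simp: C_def S_def S0(3))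
    then show "\<Inter>\<F> \<noteq> {}" by blast
  qed
  then show ?thesis using bounded(1) by (auto simp: C_def)
qed

section \<open>The Clarke derivative of a locally Lipschitz function\<close>

definition clarke_quotient :: "('x::real_normed_vector \<Rightarrow> real) \<Rightarrow> 'x \<Rightarrow> 'x \<times> real \<Rightarrow> real"
  where "clarke_quotient J z = (\<lambda>(y, t). (J (y + t *\<^sub>R z) - J y) / t)"

abbreviation clarke_filter :: "'x::real_normed_vector \<Rightarrow> ('x \<times> real) filter"
  where "clarke_filter x \<equiv> nhds x \<times>\<^sub>F at_right 0"

text \<open>The extended real value is finite for locally Lipschitz \<open>J\<close>; working with its real part keeps
  the estimates below within ordinary real arithmetic.\<close>

definition real_clarke :: "('x::real_normed_vector \<Rightarrow> real) \<Rightarrow> 'x \<Rightarrow> 'x \<Rightarrow> real"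
  where "real_clarke J x z = real_of_ereal (clarke_derivative J x z)"

lemma clarke_derivative_eq_real:
  "locally_lipschitz J \<Longrightarrow> clarke_derivative J x z = ereal (real_clarke J x z)"
  using clarke_derivative_finite[of J x z] by (simp add: real_clarke_def ereal_real)

lemma clarke_derivative_alt:
  "clarke_derivative J x z = Limsup (clarke_filter x) (\<lambda>p. ereal (clarke_quotient J z p))"
  unfolding clarke_derivative_def clarke_quotient_def by (simp add: case_prod_beta')

lemma clarke_filter_nontrivial [simp]: "clarke_filter x \<noteq> bot"
  by (simp add: prod_filter_eq_bot)

lemma eventually_clarke_quotient_less:
  assumes "locally_lipschitz J" "real_clarke J x z < c"
  shows "\<forall>\<^sub>F p in clarke_filter x. clarke_quotient J z p < c"
proof -
  have "Limsup (clarke_filter x) (\<lambda>p. ereal (clarke_quotient J z p)) < ereal c"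
    using assms clarke_derivative_eq_real[of J x z] by (simp add: clarke_derivative_alt)
  from Limsup_lessD[OF this] show ?thesis by simp
qed

lemma real_clarke_le:
  assumes "locally_lipschitz J" "\<forall>\<^sub>F p in clarke_filter x. clarke_quotient J z p \<le> c"
  shows "real_clarke J x z \<le> c"
proof -
  have "Limsup (clarke_filter x) (\<lambda>p. ereal (clarke_quotient J z p)) \<le> ereal c"
    using assms(2) by (intro Limsup_bounded) simp
  with assms(1) show ?thesis
    using clarke_derivative_eq_real[of J x z] by (simp add: clarke_derivative_alt)
qed

lemma eventually_clarke_filter_pos: "\<forall>\<^sub>F p in clarke_filter x. 0 < snd p"
  by (rule eventually_compose_filterlim[OF _ filterlim_snd]) (simp add: eventually_at_right_less)

lemma filterlim_clarke_shift:
  "filterlim (\<lambda>p. (fst p + snd p *\<^sub>R z, snd p)) (clarke_filter x) (clarke_filter x)"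
proof (rule filterlim_Pair)
  have "((\<lambda>p. fst p + snd p *\<^sub>R z) \<longlongrightarrow> x + 0 *\<^sub>R z) (clarke_filter x)"
    by (intro tendsto_intros filterlim_fst filterlim_compose[OF _ filterlim_snd] tendsto_ident_at)
  then show "((\<lambda>p. fst p + snd p *\<^sub>R z) \<longlongrightarrow> x) (clarke_filter x)" by simp
qed (rule filterlim_snd)

text \<open>The difference quotient in direction \<open>z + w\<close> at \<open>y\<close> splits into the one in direction \<open>w\<close> at \<open>y\<close>
  and the one in direction \<open>z\<close> at the shifted base point \<open>y + t *\<^sub>R w\<close>, which still tends to \<open>x\<close>.
  This is where the freedom to vary the base point in the definition pays off.\<close>

lemma real_clarke_add:
  assumes J: "locally_lipschitz J"
  shows "real_clarke J x (z + w) \<le> real_clarke J x z + real_clarke J x w"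
proof (rule field_le_epsilon)
  fix e :: real
  assume "0 < e"
  have "\<forall>\<^sub>F p in clarke_filter x. clarke_quotient J z p < real_clarke J x z + e / 2"
    using \<open>0 < e\<close> by (intro eventually_clarke_quotient_less J) simp
  then have 1: "\<forall>\<^sub>F p in clarke_filter x.
      clarke_quotient J z (fst p + snd p *\<^sub>R w, snd p) < real_clarke J x z + e / 2"
    by (rule eventually_compose_filterlim[OF _ filterlim_clarke_shift])
  have 2: "\<forall>\<^sub>F p in clarke_filter x. clarke_quotient J w p < real_clarke J x w + e / 2"
    using \<open>0 < e\<close> by (intro eventually_clarke_quotient_less J) simp
  have "real_clarke J x (z + w) \<le> (real_clarke J x z + e / 2) + (real_clarke J x w + e / 2)"
  proof (rule real_clarke_le[OF J], use 1 2 in eventually_elim)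
    case (elim p)
    have "clarke_quotient J (z + w) p
        = clarke_quotient J z (fst p + snd p *\<^sub>R w, snd p) + clarke_quotient J w p"
      by (simp add: clarke_quotient_def case_prod_beta add_divide_distrib[symmetric] algebra_simps)
    with elim show ?case by linarith
  qed
  then show "real_clarke J x (z + w) \<le> real_clarke J x z + real_clarke J x w + e" by simp
qed

lemma sublinear_real_clarke:
  assumes J: "locally_lipschitz J"
  shows "sublinear (real_clarke J x)"
proof (rule sublinearI)
  show "real_clarke J x (z + w) \<le> real_clarke J x z + real_clarke J x w" for z w
    by (rule real_clarke_add[OF J])
  have "clarke_quotient J 0 = (\<lambda>_. 0)" by (auto simp: clarke_quotient_def)
  then show "real_clarke J x 0 = 0"
    by (simp add: real_clarke_def clarke_derivative_alt Limsup_const zero_ereal_def[symmetric])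
next
  fix c :: real and z
  assume c: "0 < c"
  show "real_clarke J x (c *\<^sub>R z) \<le> c * real_clarke J x z"
  proof (rule field_le_epsilon)
    fix e :: real
    assume "0 < e"
    with c have "\<forall>\<^sub>F p in clarke_filter x. clarke_quotient J z p < real_clarke J x z + e / c"
      by (intro eventually_clarke_quotient_less J) simp
    \<comment> \<open>Homogeneity is the substitution \<open>t \<mapsto> c * t\<close> in the joint limit.\<close>
    moreover have "filterlim (\<lambda>p. (fst p, c * snd p)) (clarke_filter x) (clarke_filter x)"
    proof (rule filterlim_Pair)
      show "filterlim (\<lambda>p. c * snd p) (at_right 0) (clarke_filter x)"
      proof -
        have "((\<lambda>p. c * snd p) \<longlongrightarrow> c * 0) (clarke_filter x)"
          by (intro tendsto_intros filterlim_compose[OF _ filterlim_snd] tendsto_ident_at)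
        then show ?thesis
          using eventually_mono[OF eventually_clarke_filter_pos[of x]] c
          by (simp add: filterlim_at)
      qed
    qed (rule filterlim_fst)
    ultimately have "\<forall>\<^sub>F p in clarke_filter x.
        clarke_quotient J z (fst p, c * snd p) < real_clarke J x z + e / c"
      by (rule eventually_compose_filterlim)
    then have "\<forall>\<^sub>F p in clarke_filter x.
        clarke_quotient J (c *\<^sub>R z) p \<le> c * real_clarke J x z + e"
    proof eventually_elim
      case (elim p)
      have "clarke_quotient J (c *\<^sub>R z) p = c * clarke_quotient J z (fst p, c * snd p)"
        using c by (simp add: clarke_quotient_def case_prod_beta mult.commute)
      also have "\<dots> \<le> c * (real_clarke J x z + e / c)"
        using elim c by (intro mult_left_mono) auto
      finally show ?case using c by (simp add: distrib_left)
    qed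
    then show "real_clarke J x (c *\<^sub>R z) \<le> c * real_clarke J x z + e"
      by (rule real_clarke_le[OF J])
  qed
qed

lemma real_clarke_lipschitz_bound:
  assumes J: "locally_lipschitz J"
  obtains L where "0 \<le> L" "\<And>z. real_clarke J x z \<le> L * norm z"
proof -
  obtain U L where U: "open U" "x \<in> U" "L-lipschitz_on U J"
    using J unfolding locally_lipschitz_def by blast
  have "real_clarke J x z \<le> L * norm z" for z
  proof (rule real_clarke_le[OF J])
    have near: "\<forall>\<^sub>F p in clarke_filter x. fst p \<in> U"
      using topological_tendstoD[OF filterlim_fst U(1,2)] .
    then have "\<forall>\<^sub>F p in clarke_filter x. fst p + snd p *\<^sub>R z \<in> U"
      using eventually_compose_filterlim[OF near filterlim_clarke_shift] by simp
    with near eventually_clarke_filter_pos[of x]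
    show "\<forall>\<^sub>F p in clarke_filter x. clarke_quotient J z p \<le> L * norm z"
    proof eventually_elim
      case (elim p)
      have "\<bar>J (fst p + snd p *\<^sub>R z) - J (fst p)\<bar> \<le> L * (snd p * norm z)"
        using lipschitz_onD[OF U(3) elim(3,1)] elim(2) by (simp add: dist_norm)
      with elim(2) show ?case
        by (simp add: clarke_quotient_def case_prod_beta pos_divide_le_eq algebra_simps)
    qed
  qed
  moreover have "0 \<le> L" using lipschitz_on_nonneg[OF U(3)] .
  ultimately show thesis using that by blast
qed

lemma continuous_real_clarke:
  assumes J: "locally_lipschitz J"
  shows "continuous_on UNIV (real_clarke J x)"
proof -
  obtain L where L: "0 \<le> L" "\<And>z. real_clarke J x z \<le> L * norm z"
    using real_clarke_lipschitz_bound[OF J] by metis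
  have le: "real_clarke J x z - real_clarke J x w \<le> L * norm (z - w)" for z w
    using real_clarke_add[OF J, of x "z - w" w] L(2)[of "z - w"] by simp
  have "L-lipschitz_on UNIV (real_clarke J x)"
  proof (rule lipschitz_onI)
    fix z w
    show "dist (real_clarke J x z) (real_clarke J x w) \<le> L * dist z w"
      using le[of z w] le[of w z] by (simp add: dist_norm norm_minus_commute abs_le_iff)
  qed (rule L(1))
  then show ?thesis by (rule lipschitz_on_continuous_on)
qed

text \<open>A bound on the difference quotients near \<open>(x, 0)\<close> holds on a product neighbourhood, hence near
  \<open>(y, 0)\<close> for every \<open>y\<close> close to \<open>x\<close>.\<close>

lemma real_clarke_upper_semicontinuous:
  assumes J: "locally_lipschitz J" and less: "real_clarke J x z < c"
  shows "\<forall>\<^sub>F y in nhds x. real_clarke J y z \<le> c"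
proof -
  obtain P Q where P: "eventually P (nhds x)" and Q: "eventually Q (at_right (0::real))"
    and PQ: "\<And>y t. P y \<Longrightarrow> Q t \<Longrightarrow> clarke_quotient J z (y, t) < c"
    using eventually_clarke_quotient_less[OF assms] unfolding eventually_prod_filter by blast
  obtain U where U: "open U" "x \<in> U" "\<And>y. y \<in> U \<Longrightarrow> P y"
    using P unfolding eventually_nhds by blast
  have "real_clarke J y z \<le> c" if "y \<in> U" for y
  proof (rule real_clarke_le[OF J])
    have "eventually P (nhds y)" using U that by (auto simp: eventually_nhds)
    with Q show "\<forall>\<^sub>F p in clarke_filter y. clarke_quotient J z p \<le> c"
      unfolding eventually_prod_filter using PQ by (meson less_imp_le)
  qed
  with U(1,2) show ?thesis by (auto simp: eventually_nhds)
qed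

section \<open>Convex lower semicontinuous functions\<close>

lemma effective_domain_real:
  assumes "F v \<noteq> -\<infinity>" "v \<in> effective_domain F"
  shows "F v = ereal (real_of_ereal (F v))"
  using assms by (cases "F v") (auto simp: effective_domain_def)

lemma convex_on_effective_domain:
  fixes F :: "'v::real_vector \<Rightarrow> ereal"
  assumes proper: "\<And>v. F v \<noteq> -\<infinity>" and F: "convex_function F"
  shows "convex_on (effective_domain F) (\<lambda>v. real_of_ereal (F v))"
proof -
  have *: "F (s *\<^sub>R v + t *\<^sub>R w) \<le> ereal (s * real_of_ereal (F v) + t * real_of_ereal (F w))"
    if "v \<in> effective_domain F" "w \<in> effective_domain F" "0 \<le> s" "0 \<le> t" "s + t = 1" for v w s t
  proof -
    have "F ((1 - t) *\<^sub>R v + t *\<^sub>R w) \<le> ereal (1 - t) * F v + ereal t * F w"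
      using F that unfolding convex_function_def by simp
    moreover have "1 - t = s" using that by simp
    moreover have "F v = ereal (real_of_ereal (F v))" "F w = ereal (real_of_ereal (F w))"
      using that proper by (auto intro: effective_domain_real)
    ultimately show ?thesis
      by (metis plus_ereal.simps(1) times_ereal.simps(1))
  qed
  have dom: "s *\<^sub>R v + t *\<^sub>R w \<in> effective_domain F"
    if "v \<in> effective_domain F" "w \<in> effective_domain F" "0 \<le> s" "0 \<le> t" "s + t = 1" for v w s t
    using *[OF that] unfolding effective_domain_def by (auto intro: le_less_trans)
  show ?thesis
    unfolding convex_on_def
  proof (intro conjI convexI ballI allI impI)
    fix v w and s t :: real
    assume vw: "v \<in> effective_domain F" "w \<in> effective_domain F" "0 \<le> s" "0 \<le> t" "s + t = 1"
    show "s *\<^sub>R v + t *\<^sub>R w \<in> effective_domain F" by (rule dom[OF vw])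
    from effective_domain_real[OF proper this] *[OF vw]
    show "real_of_ereal (F (s *\<^sub>R v + t *\<^sub>R w)) \<le> s * real_of_ereal (F v) + t * real_of_ereal (F w)"
      by (metis ereal_less_eq(3))
  qed
qed

lemma closed_sublevel_lower_semicontinuous:
  fixes F :: "'v::topological_space \<Rightarrow> ereal" and k :: "'v \<Rightarrow> real"
  assumes F: "lower_semicontinuous F" and k: "continuous_on UNIV k"
  shows "closed {u. F u \<le> ereal (k u)}"
proof -
  have "\<forall>\<^sub>F y in nhds u. ereal (k y) < F y" if less: "ereal (k u) < F u" for u
  proof -
    obtain a where a: "ereal (k u) < a" "a < F u" using dense[OF less] by blast
    then obtain b where b: "a = ereal b" by (cases a) auto
    have "ereal b < Liminf (nhds u) F"
      using a b F unfolding lower_semicontinuous_def by (auto intro: less_le_trans)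
    then have "\<forall>\<^sub>F y in nhds u. ereal b < F y" by (rule less_LiminfD)
    moreover have "k \<midarrow>u\<rightarrow> k u"
      using k by (simp add: continuous_on_def)
    then have "(k \<longlongrightarrow> k u) (nhds u)" by (simp only: tendsto_at_iff_tendsto_nhds)
    then have "\<forall>\<^sub>F y in nhds u. k y < b" using a b by (intro order_tendstoD(2)) auto
    ultimately show ?thesis
      by eventually_elim (meson ereal_less_eq(3) less_ereal.simps(1) less_trans)
  qed
  then have "open {u. ereal (k u) < F u}"
    by (subst open_subopen) (simp add: eventually_nhds subset_iff Ball_def)
  moreover have "{u. ereal (k u) < F u} = - {u. F u \<le> ereal (k u)}" by auto
  ultimately show ?thesis by (simp add: closed_def)
qed

text \<open>A cone-shaped minorant, for the boundedness of sublevel sets. Lower semicontinuity bounds \<open>f\<close> from below by \<open>f v0 - 1\<close> on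
  a ball of radius \<open>r\<close>; convexity along the segment from \<open>v0\<close> to \<open>u\<close>, compared at distance \<open>r\<close>,
  extrapolates this to a bound of slope \<open>1 / r\<close>.\<close>

lemma lower_semicontinuous_convex_linear_bound:
  fixes F :: "'v::real_normed_vector \<Rightarrow> ereal"
  defines "f \<equiv> \<lambda>v. real_of_ereal (F v)"
  assumes proper: "\<And>v. F v \<noteq> -\<infinity>" and F: "convex_function F" "lower_semicontinuous F"
    and v0: "v0 \<in> effective_domain F"
  obtains K where "0 \<le> K" "\<And>u. u \<in> effective_domain F \<Longrightarrow> f v0 - 1 - K * norm (u - v0) \<le> f u"
proof -
  have conv: "convex_on (effective_domain F) f"
    unfolding f_def by (rule convex_on_effective_domain[OF proper F(1)])
  have fin: "F v = ereal (f v)" if "v \<in> effective_domain F" for v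
    unfolding f_def using effective_domain_real[OF proper that] .
  have "ereal (f v0 - 1) < F v0" by (simp add: fin[OF v0])
  also have "\<dots> \<le> Liminf (nhds v0) F" using F(2) by (simp add: lower_semicontinuous_def)
  finally have "\<forall>\<^sub>F y in nhds v0. ereal (f v0 - 1) < F y" by (rule less_LiminfD)
  then obtain d where d: "0 < d" "\<And>y. dist y v0 < d \<Longrightarrow> ereal (f v0 - 1) < F y"
    unfolding eventually_nhds_metric by blast
  define r where "r = d / 2"
  have r: "0 < r" using d by (simp add: r_def)
  have near: "f v0 - 1 \<le> f y" if "y \<in> effective_domain F" "norm (y - v0) \<le> r" for y
    using d(2)[of y] that d(1) fin[OF that(1)] by (simp add: r_def dist_norm)
  show thesis
  proof (rule that[of "1 / r"])
    show "0 \<le> 1 / r" using r by simp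
    fix u assume u: "u \<in> effective_domain F"
    show "f v0 - 1 - 1 / r * norm (u - v0) \<le> f u"
    proof (cases "norm (u - v0) \<le> r")
      case True
      with near[OF u] r show ?thesis
        by (smt (verit) divide_nonneg_nonneg mult_nonneg_nonneg norm_ge_zero)
    next
      case False
      define s where "s = r / norm (u - v0)"
      have n: "0 < norm (u - v0)" using False r by linarith
      have s: "0 < s" "s < 1" using False r n by (simp_all add: s_def)
      define w where "w = (1 - s) *\<^sub>R v0 + s *\<^sub>R u"
      have "w - v0 = s *\<^sub>R (u - v0)" by (simp add: w_def algebra_simps)
      then have "norm (w - v0) \<le> r" using n r by (simp add: s_def)
      moreover have "w \<in> effective_domain F"
        unfolding w_def using s u v0 convex_on_imp_convex[OF conv] by (intro convexD) auto
      ultimately have "f v0 - 1 \<le> f w" using near by blast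
      also have "f w \<le> (1 - s) * f v0 + s * f u"
        unfolding w_def using s u v0 by (intro convex_onD[OF conv]) auto
      finally have "s * (f v0 - f u) \<le> 1" by (simp add: algebra_simps)
      then have "f v0 - f u \<le> 1 / s" using s by (simp add: pos_le_divide_eq mult.commute)
      then show ?thesis by (simp add: s_def)
    qed
  qed
qed

section \<open>Variational-hemivariational inequalities\<close>

lemma convex_on_norm_diff_power2:
  fixes v :: "'v::real_normed_vector"
  assumes "convex S"
  shows "convex_on S (\<lambda>u. (norm (u - v))\<^sup>2)"
  unfolding convex_on_def
proof (intro conjI ballI allI impI assms)
  fix x y and s t :: real
  assume st: "0 \<le> s" "0 \<le> t" "s + t = 1"
  have "s *\<^sub>R x + t *\<^sub>R y - v = s *\<^sub>R (x - v) + t *\<^sub>R (y - v)"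
    using st(3) by (simp add: algebra_simps flip: scaleR_left_distrib)
  then have "norm (s *\<^sub>R x + t *\<^sub>R y - v) \<le> s * norm (x - v) + t * norm (y - v)"
    using norm_triangle_ineq[of "s *\<^sub>R (x - v)" "t *\<^sub>R (y - v)"] st by simp
  then have "(norm (s *\<^sub>R x + t *\<^sub>R y - v))\<^sup>2 \<le> (s * norm (x - v) + t * norm (y - v))\<^sup>2"
    by (intro power_mono) auto
  also have "\<dots> \<le> s * (norm (x - v))\<^sup>2 + t * (norm (y - v))\<^sup>2"
    using convex_power2 st unfolding convex_on_def by simp
  finally show "(norm (s *\<^sub>R x + t *\<^sub>R y - v))\<^sup>2 \<le> s * (norm (x - v))\<^sup>2 + t * (norm (y - v))\<^sup>2" .
qed

text \<open>Minty's argument: testing with \<open>p t = u + t *\<^sub>R (v - u)\<close>, dividing by \<open>t\<close> and letting \<open>t\<close> tend to \<open>0\<close>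
  moves the base point of \<open>A\<close> and of the Clarke derivative from the test point to \<open>u\<close>. The sign of
  the direction is turned by \<open>- J\<^sup>0(y; - z) \<le> J\<^sup>0(y; z)\<close>, and in the limit the upper semicontinuity of
  \<open>J\<^sup>0\<close> in the base point acts in the right direction.\<close>

lemma hemivariational_Minty:
  fixes \<gamma> :: "'v::real_normed_vector \<Rightarrow>\<^sub>L 'x::real_normed_vector"
    and A :: "'v \<Rightarrow> ('v \<Rightarrow>\<^sub>L real)"
  assumes J: "locally_lipschitz J" and f: "convex_on D f" and A: "continuous_on UNIV A"
    and u: "u \<in> D" and v: "v \<in> D"
    and Minty: "\<And>w. w \<in> D \<Longrightarrow> A w (u - w) + real_clarke J (\<gamma> w) (\<gamma> u - \<gamma> w) + f u - f w \<le> 0"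
  shows "0 \<le> A u (v - u) + real_clarke J (\<gamma> u) (\<gamma> v - \<gamma> u) + f v - f u"
proof -
  define z where "z = \<gamma> v - \<gamma> u"
  define p where "p = (\<lambda>t. u + t *\<^sub>R (v - u))"
  have sub: "sublinear (real_clarke J y)" for y by (rule sublinear_real_clarke[OF J])
  have along: "0 \<le> A (p t) (v - u) + real_clarke J (\<gamma> (p t)) z + f v - f u" if t: "0 < t" "t \<le> 1" for t
  proof -
    have p: "p t = (1 - t) *\<^sub>R u + t *\<^sub>R v" by (simp add: p_def algebra_simps)
    have pD: "p t \<in> D"
      unfolding p using t u v convex_on_imp_convex[OF f] by (intro convexD) auto
    have fp: "f (p t) \<le> (1 - t) * f u + t * f v"
      unfolding p using t u v by (intro convex_onD[OF f]) auto
    have Ap: "A (p t) (u - p t) = - t * A (p t) (v - u)"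
      by (simp add: p_def blinfun.minus_right blinfun.scaleR_right)
    have "\<gamma> u - \<gamma> (p t) = t *\<^sub>R (- z)"
      by (simp add: p_def z_def blinfun.add_right blinfun.scaleR_right blinfun.diff_right algebra_simps)
    then have Jp: "real_clarke J (\<gamma> (p t)) (\<gamma> u - \<gamma> (p t)) = t * real_clarke J (\<gamma> (p t)) (- z)"
      using sublinear_scaleR[OF sub, of t "\<gamma> (p t)" "- z"] t by simp
    have "t * (- A (p t) (v - u) - real_clarke J (\<gamma> (p t)) z + f u - f v)
        \<le> t * (- A (p t) (v - u) + real_clarke J (\<gamma> (p t)) (- z) + f u - f v)"
      using t sublinear_minus[OF sub, of "\<gamma> (p t)" z] by (intro mult_left_mono) auto
    also have "\<dots> \<le> 0"
      using Minty[OF pD] fp unfolding Ap Jp by (simp add: algebra_simps)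
    finally show ?thesis using t by (simp add: mult_le_0_iff)
  qed
  have p_lim: "(p \<longlongrightarrow> u) (at_right 0)"
  proof -
    have "(p \<longlongrightarrow> u + 0 *\<^sub>R (v - u)) (at_right 0)"
      unfolding p_def by (intro tendsto_intros)
    then show ?thesis by simp
  qed
  have "0 \<le> A u (v - u) + c + f v - f u" if c: "real_clarke J (\<gamma> u) z < c" for c
  proof (rule tendsto_lowerbound)
    have "((\<lambda>t. A (p t)) \<longlongrightarrow> A u) (at_right 0)"
      using A p_lim by (intro isCont_tendsto_compose[of u A]) (auto simp: continuous_on_eq_continuous_at)
    then show "((\<lambda>t. A (p t) (v - u) + c + f v - f u) \<longlongrightarrow> A u (v - u) + c + f v - f u) (at_right 0)"
      by (intro tendsto_intros)
    have "((\<lambda>t. \<gamma> (p t)) \<longlongrightarrow> \<gamma> u) (at_right 0)"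
      by (intro tendsto_intros p_lim)
    then have "\<forall>\<^sub>F t in at_right 0. real_clarke J (\<gamma> (p t)) z \<le> c"
      using real_clarke_upper_semicontinuous[OF J c] by (rule eventually_compose_filterlim[rotated])
    moreover have "\<forall>\<^sub>F t in at_right (0::real). 0 < t \<and> t \<le> 1"
      unfolding eventually_at_right_field by (intro exI[of _ 1]) auto
    ultimately show "\<forall>\<^sub>F t in at_right 0. 0 \<le> A (p t) (v - u) + c + f v - f u"
      by eventually_elim (use along in fastforce)
  qed simp
  then have "- (A u (v - u) + f v - f u) \<le> c" if "real_clarke J (\<gamma> u) z < c" for c
    using that by fastforce
  then have "- (A u (v - u) + f v - f u) \<le> real_clarke J (\<gamma> u) z"
    by (rule dense_ge)
  then show ?thesis by (simp add: z_def)
qed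

text \<open>The relaxed monotonicity of \<open>J\<^sup>0\<close> costs at most \<open>c\<^sub>J * (norm \<gamma>)\<^sup>2\<close> of the strong monotonicity of
  \<open>A\<close>. What is left gives uniqueness, and for existence both monotonicity and coercivity.\<close>

lemma hemivariational_monotone:
  fixes \<gamma> :: "'v::real_normed_vector \<Rightarrow>\<^sub>L 'x::real_normed_vector"
    and A :: "'v \<Rightarrow> ('v \<Rightarrow>\<^sub>L real)"
  assumes A: "strongly_monotone A c\<^sub>A" and "0 \<le> c\<^sub>J"
    and J: "\<And>y1 y2. real_clarke J y1 (y2 - y1) + real_clarke J y2 (y1 - y2) \<le> c\<^sub>J * (norm (y1 - y2))\<^sup>2"
  shows "A v (w - v) + real_clarke J (\<gamma> v) (\<gamma> w - \<gamma> v) + (A w (v - w) + real_clarke J (\<gamma> w) (\<gamma> v - \<gamma> w))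
    + (c\<^sub>A - c\<^sub>J * (norm \<gamma>)\<^sup>2) * (norm (v - w))\<^sup>2 \<le> 0"
proof -
  have "c\<^sub>A * (norm (v - w))\<^sup>2 \<le> (A v - A w) (v - w)"
    using A by (simp add: strongly_monotone_def)
  moreover have "(A v - A w) (v - w) = - (A v (w - v) + A w (v - w))"
    by (simp add: blinfun.diff_left blinfun.diff_right)
  moreover have "(norm (\<gamma> v - \<gamma> w))\<^sup>2 \<le> (norm \<gamma> * norm (v - w))\<^sup>2"
    using norm_blinfun[of \<gamma> "v - w"] by (intro power_mono) (auto simp: blinfun.diff_right)
  then have "c\<^sub>J * (norm (\<gamma> v - \<gamma> w))\<^sup>2 \<le> c\<^sub>J * (norm \<gamma>)\<^sup>2 * (norm (v - w))\<^sup>2"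
    using \<open>0 \<le> c\<^sub>J\<close> mult_left_mono by (fastforce simp: power_mult_distrib mult.assoc)
  moreover note J[of "\<gamma> v" "\<gamma> w"]
  ultimately show ?thesis by (simp add: left_diff_distrib)
qed

lemma bounded_if_quadratic_le_linear:
  fixes m K \<rho> :: real
  assumes "0 < m" "0 \<le> K" "0 \<le> \<rho>" "m * \<rho>\<^sup>2 \<le> 1 + K * \<rho>"
  shows "\<rho> \<le> max 1 ((1 + K) / m)"
proof (cases "\<rho> \<le> 1")
  case False
  then have "\<rho> * (m * \<rho>) \<le> \<rho> * (1 + K)"
    using assms by (simp add: power2_eq_square algebra_simps)
  then have "m * \<rho> \<le> 1 + K" using False by simp
  then have "\<rho> \<le> (1 + K) / m" using assms(1) by (simp add: pos_le_divide_eq mult.commute)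
  then show ?thesis by simp
qed simp

theorem hemivariational_exists:
  fixes \<gamma> :: "'v::real_normed_vector \<Rightarrow>\<^sub>L 'x::real_normed_vector"
    and A :: "'v \<Rightarrow> ('v \<Rightarrow>\<^sub>L real)" and F :: "'v \<Rightarrow> ereal"
  defines "f \<equiv> \<lambda>v. real_of_ereal (F v)" and "D \<equiv> effective_domain F"
  assumes refl: "reflexive_space TYPE('v)" and J: "locally_lipschitz J"
    and F: "\<And>v. F v \<noteq> -\<infinity>" "convex_function F" "lower_semicontinuous F" "proper_function F"
    and A: "continuous_on UNIV A" "strongly_monotone A c\<^sub>A" and "0 \<le> c\<^sub>J"
    and relaxed: "\<And>y1 y2. real_clarke J y1 (y2 - y1) + real_clarke J y2 (y1 - y2) \<le> c\<^sub>J * (norm (y1 - y2))\<^sup>2"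
    and small: "c\<^sub>J * (norm \<gamma>)\<^sup>2 < c\<^sub>A"
  shows "\<exists>u\<in>D. \<forall>v\<in>D. 0 \<le> A u (v - u) + real_clarke J (\<gamma> u) (\<gamma> v - \<gamma> u) + f v - f u"
proof -
  define m where "m = c\<^sub>A - c\<^sub>J * (norm \<gamma>)\<^sup>2"
  have m: "0 < m" using small by (simp add: m_def)
  \<comment> \<open>Monotonicity leaves a surplus of \<open>m * (norm (v - w))\<^sup>2\<close>. Half of it in each of \<open>\<psi> v w\<close> and
    \<open>\<psi> w v\<close> keeps their sum nonpositive, and makes the sublevel sets of \<open>\<psi> v\<close> bounded.\<close>
  define \<psi> where "\<psi> = (\<lambda>v u. A v (u - v) + real_clarke J (\<gamma> v) (\<gamma> u - \<gamma> v) + f u - f v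
    + m / 2 * (norm (u - v))\<^sup>2)"
  have conv: "convex_on D f"
    unfolding f_def D_def by (rule convex_on_effective_domain[OF F(1,2)])
  have fin: "F v = ereal (f v)" if "v \<in> D" for v
    unfolding f_def using effective_domain_real[of F v] F(1) that by (simp add: D_def)
  have sub: "sublinear (real_clarke J y)" for y by (rule sublinear_real_clarke[OF J])
  obtain v0 where v0: "v0 \<in> D" using F(4) by (auto simp: proper_function_def D_def)
  have "\<exists>u\<in>D. \<forall>v\<in>D. \<psi> v u \<le> 0"
  proof (rule monotone_equilibrium[OF refl])
    fix v w assume "v \<in> D" "w \<in> D"
    show "\<psi> v w + \<psi> w v \<le> 0"
      using hemivariational_monotone[OF A(2) \<open>0 \<le> c\<^sub>J\<close> relaxed, where v = v and w = w and \<gamma> = \<gamma>]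
      unfolding \<psi>_def m_def[symmetric] norm_minus_commute[of w v] by linarith
  next
    fix v assume v: "v \<in> D"
    show "convex_on D (\<psi> v)"
      unfolding convex_on_def
    proof (intro conjI ballI allI impI)
      show D: "convex D" by (rule convex_on_imp_convex[OF conv])
      fix x y and s t :: real
      assume *: "x \<in> D" "y \<in> D" "0 \<le> s" "0 \<le> t" "s + t = 1"
      have comb: "s *\<^sub>R x + t *\<^sub>R y - v = s *\<^sub>R (x - v) + t *\<^sub>R (y - v)"
        using *(5) by (simp add: algebra_simps flip: scaleR_left_distrib)
      have "A v (s *\<^sub>R x + t *\<^sub>R y - v) = s * A v (x - v) + t * A v (y - v)"
        unfolding comb by (simp add: blinfun.add_right blinfun.scaleR_right)
      moreover have "real_clarke J (\<gamma> v) (\<gamma> (s *\<^sub>R x + t *\<^sub>R y) - \<gamma> v)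
          \<le> s * real_clarke J (\<gamma> v) (\<gamma> x - \<gamma> v) + t * real_clarke J (\<gamma> v) (\<gamma> y - \<gamma> v)"
      proof -
        have "\<gamma> (s *\<^sub>R x + t *\<^sub>R y) - \<gamma> v = s *\<^sub>R (\<gamma> x - \<gamma> v) + t *\<^sub>R (\<gamma> y - \<gamma> v)"
          using comb by (metis blinfun.add_right blinfun.diff_right blinfun.scaleR_right)
        with sublinear_add[OF sub, of "\<gamma> v" "s *\<^sub>R (\<gamma> x - \<gamma> v)" "t *\<^sub>R (\<gamma> y - \<gamma> v)"]
        show ?thesis using * by (simp add: sublinear_scaleR[OF sub])
      qed
      moreover have "f (s *\<^sub>R x + t *\<^sub>R y) \<le> s * f x + t * f y"
        using conv * by (simp add: convex_on_def)
      moreover have "m / 2 * (norm (s *\<^sub>R x + t *\<^sub>R y - v))\<^sup>2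
          \<le> m / 2 * (s * (norm (x - v))\<^sup>2 + t * (norm (y - v))\<^sup>2)"
        using convex_on_norm_diff_power2[OF D, of v] * m
        by (intro mult_left_mono) (auto simp: convex_on_def)
      moreover have "f v = s * f v + t * f v" using *(5) by (simp flip: distrib_right)
      ultimately show "\<psi> v (s *\<^sub>R x + t *\<^sub>R y) \<le> s * \<psi> v x + t * \<psi> v y"
        unfolding \<psi>_def by (simp add: algebra_simps)
    qed
    define k where "k = (\<lambda>u. f v - A v (u - v) - real_clarke J (\<gamma> v) (\<gamma> u - \<gamma> v)
      - m / 2 * (norm (u - v))\<^sup>2)"
    have "continuous_on UNIV k"
      unfolding k_def
      by (intro continuous_intros continuous_on_compose2[OF continuous_real_clarke[OF J]]) auto
    moreover have "{u\<in>D. \<psi> v u \<le> 0} = {u. F u \<le> ereal (k u)}"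
    proof -
      have "u \<in> D" if "F u \<le> ereal (k u)" for u
        using that by (auto simp: D_def effective_domain_def intro: le_less_trans)
      moreover have "\<psi> v u \<le> 0 \<longleftrightarrow> F u \<le> ereal (k u)" if "u \<in> D" for u
        unfolding fin[OF that] \<psi>_def k_def by (simp only: ereal_less_eq(3)) linarith
      ultimately show ?thesis by blast
    qed
    ultimately show "closed {u\<in>D. \<psi> v u \<le> 0}"
      using closed_sublevel_lower_semicontinuous[OF F(3)] by simp
  next
    show "v0 \<in> D" by (rule v0)
    \<comment> \<open>All terms of \<open>\<psi> v0 u\<close> but the quadratic one decrease at most linearly in \<open>norm (u - v0)\<close>.\<close>
    obtain L where L: "0 \<le> L" "\<And>z. real_clarke J (\<gamma> v0) z \<le> L * norm z"
      using real_clarke_lipschitz_bound[OF J] by metis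
    obtain K where K: "0 \<le> K" "\<And>u. u \<in> D \<Longrightarrow> f v0 - 1 - K * norm (u - v0) \<le> f u"
      using lower_semicontinuous_convex_linear_bound[OF F(1-3)] v0 unfolding D_def f_def by metis
    define K' where "K' = norm (A v0) + L * norm \<gamma> + K"
    have "norm (u - v0) \<le> max 1 ((1 + K') / (m / 2))" if u: "u \<in> D" "\<psi> v0 u \<le> 0" for u
    proof (rule bounded_if_quadratic_le_linear)
      have "\<bar>A v0 (u - v0)\<bar> \<le> norm (A v0) * norm (u - v0)"
        using norm_blinfun[of "A v0" "u - v0"] by simp
      moreover have "- (L * (norm \<gamma> * norm (u - v0))) \<le> real_clarke J (\<gamma> v0) (\<gamma> u - \<gamma> v0)"
      proof -
        have "norm (\<gamma> v0 - \<gamma> u) \<le> norm \<gamma> * norm (u - v0)"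
          using norm_blinfun[of \<gamma> "u - v0"] by (simp add: blinfun.diff_right norm_minus_commute)
        then have "real_clarke J (\<gamma> v0) (\<gamma> v0 - \<gamma> u) \<le> L * (norm \<gamma> * norm (u - v0))"
          using L(2)[of "\<gamma> v0 - \<gamma> u"] L(1) by (meson mult_left_mono order_trans)
        then show ?thesis using sublinear_minus[OF sub, of "\<gamma> v0" "\<gamma> u - \<gamma> v0"] by simp
      qed
      moreover note K(2)[OF u(1)] u(2)
      ultimately show "m / 2 * (norm (u - v0))\<^sup>2 \<le> 1 + K' * norm (u - v0)"
        unfolding \<psi>_def K'_def by (simp add: algebra_simps)
    qed (use m L(1) K(1) in \<open>auto simp: K'_def\<close>)
    then have "{u\<in>D. \<psi> v0 u \<le> 0} \<subseteq> cball v0 (max 1 ((1 + K') / (m / 2)))"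
      by (auto simp: dist_norm norm_minus_commute simp del: max.bounded_iff)
    then show "bounded {u\<in>D. \<psi> v0 u \<le> 0}" by (rule bounded_subset[OF bounded_cball])
  qed
  then obtain u where u: "u \<in> D" "\<And>v. v \<in> D \<Longrightarrow> \<psi> v u \<le> 0" by blast
  \<comment> \<open>The quadratic term has served its purpose: Minty's argument starts from the inequality without it.\<close>
  have "A w (u - w) + real_clarke J (\<gamma> w) (\<gamma> u - \<gamma> w) + f u - f w \<le> 0" if "w \<in> D" for w
  proof -
    have "0 \<le> m / 2 * (norm (u - w))\<^sup>2" using m by simp
    with u(2)[OF that] show ?thesis unfolding \<psi>_def by linarith
  qed
  then show ?thesis
    using hemivariational_Minty[OF J conv A(1) u(1)] u(1) by blast
qed

theorem hemivariational_unique: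
  fixes \<gamma> :: "'v::real_normed_vector \<Rightarrow>\<^sub>L 'x::real_normed_vector"
    and A :: "'v \<Rightarrow> ('v \<Rightarrow>\<^sub>L real)"
  assumes A: "strongly_monotone A c\<^sub>A" and "0 \<le> c\<^sub>J"
    and relaxed: "\<And>y1 y2. real_clarke J y1 (y2 - y1) + real_clarke J y2 (y1 - y2) \<le> c\<^sub>J * (norm (y1 - y2))\<^sup>2"
    and small: "c\<^sub>J * (norm \<gamma>)\<^sup>2 < c\<^sub>A"
    and u: "0 \<le> A u (w - u) + real_clarke J (\<gamma> u) (\<gamma> w - \<gamma> u) + f w - f u"
    and w: "0 \<le> A w (u - w) + real_clarke J (\<gamma> w) (\<gamma> u - \<gamma> w) + f u - f w"
  shows "u = w"
proof -
  have "(c\<^sub>A - c\<^sub>J * (norm \<gamma>)\<^sup>2) * (norm (u - w))\<^sup>2 \<le> 0"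
    using hemivariational_monotone[OF A \<open>0 \<le> c\<^sub>J\<close> relaxed, where v = u and w = w and \<gamma> = \<gamma>] u w by linarith
  with small show ?thesis by (simp add: mult_le_0_iff)
qed

theorem theorem4:
  fixes \<gamma> :: "'v::banach \<Rightarrow>\<^sub>L 'x::{real_inner, complete_space}"
    and J :: "'x \<Rightarrow> real"
    and F :: "'v \<Rightarrow> ereal"
    and A :: "'v \<Rightarrow> ('v \<Rightarrow>\<^sub>L real)"
    and c\<^sub>A c\<^sub>J :: real
  assumes "reflexive_space TYPE('v)"
    and "locally_lipschitz J"
    and "\<And>v. F v \<noteq> -\<infinity>"
    and "convex_function F"
    and "lower_semicontinuous F"
    and "proper_function F"
    and "continuous_on UNIV A"
    and "c\<^sub>A > 0"
    and "strongly_monotone A c\<^sub>A"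
    and "c\<^sub>J > 0"
    and "\<And>y1 y2. clarke_derivative J y1 (y2 - y1) + clarke_derivative J y2 (y1 - y2)
           \<le> ereal (c\<^sub>J * (norm (y1 - y2))\<^sup>2)"
    and "c\<^sub>J * (norm \<gamma>)\<^sup>2 < c\<^sub>A"
  shows "\<exists>!v'. v' \<in> effective_domain F \<and>
    (\<forall>v. ereal (blinfun_apply (A v') (v - v'))
         + clarke_derivative J (blinfun_apply \<gamma> v') (blinfun_apply \<gamma> v - blinfun_apply \<gamma> v')
         + F v - F v' \<ge> 0)"
proof -
  let ?D = "effective_domain F"
  let ?f = "\<lambda>v. real_of_ereal (F v)"
  let ?g = "\<lambda>u v. A u (v - u) + real_clarke J (\<gamma> u) (\<gamma> v - \<gamma> u) + ?f v - ?f u"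
  have c: "0 \<le> c\<^sub>J" using assms(10) by simp
  have relaxed: "real_clarke J y1 (y2 - y1) + real_clarke J y2 (y1 - y2) \<le> c\<^sub>J * (norm (y1 - y2))\<^sup>2"
    for y1 y2
    using assms(11)[of y1 y2] by (simp add: clarke_derivative_eq_real[OF assms(2)])
  \<comment> \<open>Outside the effective domain the left-hand side is \<open>\<infinity>\<close>, so only \<open>v\<close> in the domain matter; there
    all terms are real.\<close>
  have equiv: "(\<forall>v. ereal (A u (v - u)) + clarke_derivative J (\<gamma> u) (\<gamma> v - \<gamma> u) + F v - F u \<ge> 0)
      \<longleftrightarrow> (\<forall>v\<in>?D. 0 \<le> ?g u v)" if u: "u \<in> ?D" for u
  proof -
    have Fu: "F u = ereal (?f u)" by (rule effective_domain_real[OF assms(3) u])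
    have "ereal (A u (v - u)) + clarke_derivative J (\<gamma> u) (\<gamma> v - \<gamma> u) + F v - F u \<ge> 0
      \<longleftrightarrow> (v \<in> ?D \<longrightarrow> 0 \<le> ?g u v)" for v
    proof (cases "v \<in> ?D")
      case True
      have "F v = ereal (?f v)" by (rule effective_domain_real[OF assms(3) True])
      then have "ereal (A u (v - u)) + clarke_derivative J (\<gamma> u) (\<gamma> v - \<gamma> u) + F v - F u = ereal (?g u v)"
        using Fu clarke_derivative_eq_real[OF assms(2)]
        by (metis ereal_minus(1) plus_ereal.simps(1))
      with True show ?thesis by (simp add: zero_ereal_def)
    next
      case False
      then have "F v = \<infinity>" by (simp add: effective_domain_def)
      with False show ?thesis
        by (subst Fu) (simp add: clarke_derivative_eq_real[OF assms(2)])
    qed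
    then show ?thesis by blast
  qed
  obtain u where u: "u \<in> ?D" "\<forall>v\<in>?D. 0 \<le> ?g u v"
    using hemivariational_exists[OF assms(1-7,9) c relaxed assms(12)] by blast
  show ?thesis
  proof (rule ex1I[of _ u])
    show "u \<in> ?D \<and> (\<forall>v. ereal (A u (v - u)) + clarke_derivative J (\<gamma> u) (\<gamma> v - \<gamma> u) + F v - F u \<ge> 0)"
      using u equiv by blast
  next
    fix w
    assume w: "w \<in> ?D \<and> (\<forall>v. ereal (A w (v - w)) + clarke_derivative J (\<gamma> w) (\<gamma> v - \<gamma> w) + F v - F w \<ge> 0)"
    then have "\<forall>v\<in>?D. 0 \<le> ?g w v" using equiv by blast
    with u w have "0 \<le> ?g u w" "0 \<le> ?g w u" by auto
    then show "w = u"
      using hemivariational_unique[OF assms(9) c relaxed assms(12), where u = u and w = w and f = ?f] by simp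
  qed
qed

end
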